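(* Let $R$ be a partially ordered ring whose pure trace space $X = X(R)$ is connected, and let $s$ be an element of $R$. Put $S(s) = \{r\in R : rs\ge 0\}$ and $sS(s) = \{rs : r\in S(s)\}\subseteq R^+$. Suppose that (a) $\{x\in X : x(s)=0\}$ is nowhere dense in $X$; (b) the ideal of $R$ generated by $\langle sS(s)\rangle\cup S(s)$ is $R$, where $\langle sS(s)\rangle$ is the order ideal generated by $sS(s)$. Then one of $\pm s$ belongs to $R^+$.
   Context: A partially ordered ring $R$ is a commutative unital ring with a subset $R^+$ (the positive cone) making $R$ a partially ordered abelian group under addition ($r\ge s$ means $r-s\in R^+$), such that $R^+\cdot R^+ = R^+$, the group is unperforated (if $n$ is a positive integer, $g \in R$ and $ng\in R^+$, then $g\in R^+$), and $1$ is an order unit (for every $g\in R$ there is a positive integer $M$ with $-M\cdot 1\le g\le M\cdot 1$). The pure trace space $X(R)$ is the set of positive unital ring homomorphisms $x: R\to\mathbb{R}$ (positive means $x(R^+)\subseteq[0,\infty)$), equipped with the point-open topology (pointwise convergence on $R$); it is a compact Hausdorff space. An order ideal of $R$ is a subgroup $I$ that is convex ($0\le g\le h$ with $h\in I$, $g\in R$ implies $g\in I$) and directed ($I$ is generated as a group by $I\cap R^+$). For $T\subseteq R^+$, the order ideal generated by $T$ is $$\langle T\rangle = \Big\{r\in R : \text{there exist a positive integer } M \text{ and a finite } \{t_i\}\subseteq T \text{ with } -M\sum t_i\le r\le M\sum t_i\Big\}.$$ *)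

theory Defs
  imports "HOL-Analysis.Analysis"
begin

text \<open>The positive cone is \<open>{r. 0 \<le> r}\<close>; the class \<^class>\<open>ordered_ab_group_add\<close> supplies the
  partially ordered abelian group.\<close>

class partially_ordered_ring = comm_ring_1 + ordered_ab_group_add +
  assumes cone_mult_cone: "{a * b | a b. 0 \<le> a \<and> 0 \<le> b} = {r. 0 \<le> r}"
    and unperforated: "0 < n \<Longrightarrow> 0 \<le> of_nat n * g \<Longrightarrow> 0 \<le> g"
    and one_order_unit: "\<exists>M>0. - of_nat M \<le> g \<and> g \<le> of_nat M"

text \<open>The topology of pointwise convergence is the one the function type \<open>'a \<Rightarrow> real\<close> carries
  as an instance of \<^class>\<open>topological_space\<close> (the product topology).\<close>

definition pure_traces :: "('a::partially_ordered_ring \<Rightarrow> real) set" where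
  "pure_traces = {x. x 1 = 1 \<and> (\<forall>a b. x (a + b) = x a + x b) \<and>
     (\<forall>a b. x (a * b) = x a * x b) \<and> (\<forall>a. 0 \<le> a \<longrightarrow> 0 \<le> x a)}"

definition nowhere_dense_in :: "'b topology \<Rightarrow> 'b set \<Rightarrow> bool" where
  "nowhere_dense_in T A \<longleftrightarrow> T interior_of (T closure_of A) = {}"

definition generated_order_ideal :: "'a::partially_ordered_ring set \<Rightarrow> 'a set" where
  "generated_order_ideal T = {r. \<exists>M F. 0 < M \<and> finite F \<and> F \<subseteq> T \<and>
     - (of_nat M * \<Sum>F) \<le> r \<and> r \<le> of_nat M * \<Sum>F}"

definition is_ideal :: "'a::comm_ring_1 set \<Rightarrow> bool" where
  "is_ideal I \<longleftrightarrow> 0 \<in> I \<and> (\<forall>a\<in>I. \<forall>b\<in>I. a + b \<in> I) \<and> (\<forall>r. \<forall>a\<in>I. r * a \<in> I)"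

definition multipliers :: "'a::partially_ordered_ring \<Rightarrow> 'a set" where
  "multipliers s = {r. 0 \<le> r * s}"

end

theory Submission
  imports Defs
begin

text \<open>
  Put \<open>S = S(s)\<close> and \<open>J = \<langle>sS\<rangle>\<close>, which is a ring ideal. By (b) every pure trace is nonzero at
  some \<open>r \<in> S\<close>, and \<open>rs \<ge> 0\<close> then forces \<open>s\<close> to have constant sign near that trace. By (a) and
  connectedness the sign is global, say \<open>s \<ge> 0\<close> on \<open>X\<close>, and then all of \<open>S\<close> is nonnegative
  on \<open>X\<close>. Applying (b) to the ideal of those \<open>a\<close> whose modulus is dominated on \<open>X\<close> by an element
  of \<open>S\<close> yields \<open>t \<in> S\<close> with \<open>t \<ge> 1\<close> on \<open>X\<close>. Applying (b) to the ideal \<open>{a. as \<in> J}\<close> yields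
  \<open>s \<in> J\<close>, so \<open>s \<ge> - Mt's\<close> for some \<open>t' \<in> S\<close>. The sum \<open>u = t + t'\<close> is strictly positive on \<open>X\<close>,
  hence a positive element by the Kadison-Dubois representation theorem, and
  \<open>0 \<le> us\<close>, \<open>-Mus \<le> s\<close>. Multiplying \<open>Ns + Kus \<ge> 0\<close> by \<open>N - u\<close>, where \<open>0 \<le> u \<le> N\<close>, lowers \<open>K\<close>
  by one, and descending to \<open>K = 0\<close> gives \<open>s \<ge> 0\<close>.

  The representation theorem comes from a maximal proper module over the positive cone: it
  defines a total preorder on \<open>R\<close>, its unique state is multiplicative, and the same descent shows
  that the module generated by \<open>- r\<close> is proper unless \<open>Nr \<ge> 1\<close> for some \<open>N\<close>.
\<close>

section \<open>Arithmetic of the positive cone\<close>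

context partially_ordered_ring
begin

lemma cone_mult: "0 \<le> a \<Longrightarrow> 0 \<le> b \<Longrightarrow> 0 \<le> a * b"
  using cone_mult_cone by blast

text \<open>The order-unit bound at \<open>0\<close> makes some positive integer multiple of
  \<open>1\<close> nonnegative, and unperforatedness cancels the integer.\<close>

lemma cone_one: "0 \<le> 1"
proof -
  obtain M where M: "M > 0" "- of_nat M \<le> 0" using one_order_unit[of 0] by blast
  then have "0 \<le> of_nat M * 1" by simp
  with M(1) show ?thesis by (rule unperforated)
qed

lemma cone_of_nat: "0 \<le> of_nat n"
  by (induction n) (auto intro: add_nonneg_nonneg cone_one)

lemma order_unit_bound:
  obtains N where "0 < N" "0 \<le> of_nat N - a" "0 \<le> of_nat N + a"
proof -
  obtain N where "N > 0" "- of_nat N \<le> a" "a \<le> of_nat N" using one_order_unit by blast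
  moreover from this(2) have "0 \<le> of_nat N + a"
    using add_left_mono[of "- of_nat N" a "of_nat N"] by simp
  ultimately show thesis by (intro that) auto
qed

text \<open>Everything rests on the identity \<open>N (N r + K p - p) = (N - b) (N r + K p) + N (b r
  - p) + K b p\<close>, whose right-hand terms are all nonnegative. Unperforatedness cancels
  \<open>N\<close>, so one copy of \<open>p\<close> can be removed at a time; the last removal, at
  \<open>K = 0\<close>, is the conclusion.\<close>

lemma descent:
  assumes N: "0 < N" "0 \<le> b" "0 \<le> of_nat N - b"
    and p: "0 \<le> p" "p \<le> b * r" and K: "0 \<le> of_nat N * r + of_nat K * p"
  shows "p \<le> of_nat N * r"
  using K
proof (induction K)
  have step: "0 \<le> of_nat N * r + of_nat K * p - p" if "0 \<le> of_nat N * r + of_nat K * p" for K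
  proof -
    have "0 \<le> (of_nat N - b) * (of_nat N * r + of_nat K * p) + of_nat N * (b * r - p)
        + of_nat K * (b * p)"
      using cone_mult[OF N(3) that] cone_mult[OF cone_of_nat, of "b * r - p"]
        cone_mult[OF cone_of_nat cone_mult[OF N(2) p(1)]] p(2)
      by (intro add_nonneg_nonneg) simp_all
    also have "\<dots> = of_nat N * (of_nat N * r + of_nat K * p - p)"
      by (simp add: algebra_simps)
    finally show ?thesis using N(1) unperforated by blast
  qed
  {
    case 0
    then show ?case using step[of 0] by simp
  next
    case (Suc K)
    have "of_nat N * r + of_nat (Suc K) * p - p = of_nat N * r + of_nat K * p"
      by (simp add: algebra_simps)
    then show ?case using Suc.IH step[OF Suc.prems] by simp
  }
qed

end

section \<open>Modules over the positive cone\<close>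

definition cone_module :: "'a::partially_ordered_ring set \<Rightarrow> bool" where
  "cone_module P \<longleftrightarrow> (\<forall>a\<ge>0. a \<in> P) \<and> (\<forall>a\<in>P. \<forall>b\<in>P. a + b \<in> P) \<and>
     (\<forall>t\<ge>0. \<forall>a\<in>P. t * a \<in> P)"

lemma
  assumes "cone_module P"
  shows cone_module_nonneg: "0 \<le> a \<Longrightarrow> a \<in> P"
    and cone_module_add: "a \<in> P \<Longrightarrow> b \<in> P \<Longrightarrow> a + b \<in> P"
    and cone_module_mult: "0 \<le> t \<Longrightarrow> a \<in> P \<Longrightarrow> t * a \<in> P"
  using assms unfolding cone_module_def by auto

lemma cone_module_extend:
  fixes P :: "'a::partially_ordered_ring set" and a :: 'a
  assumes "cone_module P"
  defines "Q \<equiv> {m + t * a | m t. m \<in> P \<and> 0 \<le> t}"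
  shows "cone_module Q" "P \<subseteq> Q" "a \<in> Q"
proof -
  note [intro] = cone_module_nonneg[OF assms(1)] cone_module_add[OF assms(1)]
    cone_module_mult[OF assms(1)]
  have Q: "m + t * a \<in> Q" if "m \<in> P" "0 \<le> t" for m t
    using that unfolding Q_def by blast
  show "P \<subseteq> Q"
    using Q[where t = 0] by auto
  show "a \<in> Q"
    using Q[of 0 1] cone_one by auto
  show "cone_module Q"
    unfolding cone_module_def
  proof (intro conjI allI ballI impI)
    show "b \<in> Q" if "0 \<le> b" for b
      using that \<open>P \<subseteq> Q\<close> by blast
  next
    fix b c assume "b \<in> Q" "c \<in> Q"
    then obtain m t m' t' where "b = m + t * a" "c = m' + t' * a" "m \<in> P" "m' \<in> P" "0 \<le> t" "0 \<le> t'"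
      unfolding Q_def by blast
    then have "b + c = (m + m') + (t + t') * a" "m + m' \<in> P" "0 \<le> t + t'"
      by (auto simp: algebra_simps)
    then show "b + c \<in> Q" using Q by metis
  next
    fix c b :: 'a assume "0 \<le> c" "b \<in> Q"
    then obtain m t where "b = m + t * a" "m \<in> P" "0 \<le> t"
      unfolding Q_def by blast
    then have "c * b = c * m + (c * t) * a" "c * m \<in> P" "0 \<le> c * t"
      using \<open>0 \<le> c\<close> by (auto simp: algebra_simps intro: cone_mult)
    then show "c * b \<in> Q" using Q by metis
  qed
qed

text \<open>If neither \<open>a\<close> nor \<open>- a\<close> lies in \<open>P\<close>, adjoining
  either one produces \<open>- 1\<close>. Combining the two expressions for \<open>- 1\<close>
  eliminates \<open>a\<close> and leaves \<open>- t \<in> P\<close>, from which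
  \<open>t * a\<close>, and then \<open>- 1\<close>, is recovered in \<open>P\<close>.\<close>

lemma maximal_cone_module_total:
  fixes P :: "'a::partially_ordered_ring set"
  assumes P: "cone_module P" and "- 1 \<notin> P"
    and max: "\<And>Q. cone_module Q \<Longrightarrow> P \<subseteq> Q \<Longrightarrow> - 1 \<notin> Q \<Longrightarrow> Q = P"
  shows "a \<in> P \<or> - a \<in> P"
proof (rule ccontr)
  assume neg: "\<not> ?thesis"
  have *: "\<exists>m t. m \<in> P \<and> 0 \<le> t \<and> - 1 = m + t * b" if "b \<notin> P" for b
    using cone_module_extend[OF P, of b] max that by blast
  obtain m t where m: "m \<in> P" "0 \<le> t" "- 1 = m + t * a" using * neg by blast
  obtain m' t' where m': "m' \<in> P" "0 \<le> t'" "- 1 = m' + t' * (- a)" using * neg by blast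
  have "t' * m + t * m' + t' \<in> P"
    by (intro cone_module_add[OF P] cone_module_mult[OF P] cone_module_nonneg[OF P] m m')
  moreover have "t' * m + t * m' + t' = - t"
  proof -
    have eqs: "m = - 1 - t * a" "m' = - 1 + t' * a"
      using m(3) m'(3) by (auto simp: eq_diff_eq algebra_simps)
    show ?thesis unfolding eqs by (simp add: algebra_simps)
  qed
  ultimately have t: "- t \<in> P" by simp
  \<comment> \<open>Since \<open>t\<close> and \<open>- t\<close> both lie in \<open>P\<close>,
    \<open>t * a = (N - a) * (- t) + N * t\<close> does too, although \<open>a\<close> may have no
    sign.\<close>
  obtain N where N: "0 \<le> of_nat N - a" using order_unit_bound by blast
  have "(of_nat N - a) * (- t) + of_nat N * t \<in> P"
    by (intro cone_module_add[OF P] cone_module_mult[OF P] cone_of_nat N t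
        cone_module_nonneg[OF P m(2)])
  then have "t * a \<in> P" by (simp add: algebra_simps)
  then have "- 1 \<in> P" using m cone_module_add[OF P] by metis
  with assms(2) show False ..
qed

text \<open>A negative \<open>k\<close> in \<open>P\<close> could be raised to exactly
  \<open>- 1\<close> by adding the natural number \<open>- 1 - k\<close>.\<close>

lemma cone_module_of_int:
  assumes P: "cone_module P" "- 1 \<notin> P" and k: "of_int k \<in> P"
  shows "0 \<le> k"
proof (rule ccontr)
  assume "\<not> 0 \<le> k"
  have "of_int k + of_nat (nat (- 1 - k)) \<in> P"
    by (intro cone_module_add[OF P(1)] k cone_module_nonneg[OF P(1)] cone_of_nat)
  also have "of_int k + of_nat (nat (- 1 - k)) = (of_int (k + int (nat (- 1 - k))) :: 'a)"
    by (simp only: of_int_add of_int_of_nat_eq)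
  also have "\<dots> = - 1" using \<open>\<not> 0 \<le> k\<close> by simp
  finally show False using P by blast
qed

section \<open>States and pure traces of total cone modules\<close>

lemma ex_fraction_between:
  fixes x y :: real
  assumes "x < y"
  obtains n :: nat and p :: int where "0 < n" "x < p / n" "p / n < y"
proof -
  obtain q where q: "q \<in> \<rat>" "x < q" "q < y" using Rats_dense_in_real[OF assms] by blast
  then obtain p :: int and n :: nat where "n > 0" "q = p / n"
    by (metis Rats_cases' of_int_of_nat_eq zero_less_imp_eq_int)
  then show thesis using that q by blast
qed

lemma additive_of_nat:
  fixes f :: "'a::comm_ring_1 \<Rightarrow> real"
  assumes add: "\<And>a b. f (a + b) = f a + f b"
  shows "f (of_nat n * a) = of_nat n * f a"
proof (induction n)
  case 0
  then show ?case using add[of 0 0] by simp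
next
  case (Suc n)
  then show ?case using add by (simp add: algebra_simps)
qed

lemma additive_diff:
  fixes f :: "'a::comm_ring_1 \<Rightarrow> real"
  assumes add: "\<And>a b. f (a + b) = f a + f b"
  shows "f (a - b) = f a - f b"
  using add[of "a - b" b] by simp

lemma additive_of_int:
  fixes f :: "'a::comm_ring_1 \<Rightarrow> real"
  assumes add: "\<And>a b. f (a + b) = f a + f b"
  shows "f (of_int k) = of_int k * f 1"
proof (cases k rule: int_cases2)
  case (nonneg n)
  then show ?thesis using additive_of_nat[of f n 1, OF add] by simp
next
  case (nonpos n)
  then show ?thesis using additive_of_nat[of f n 1, OF add] additive_of_nat[of f 0 1, OF add]
      additive_diff[of f 0 "of_nat n", OF add] by simp
qed

lemma
  assumes "x \<in> pure_traces"
  shows trace_one: "x 1 = 1"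
    and trace_add: "x (a + b) = x a + x b"
    and trace_mult: "x (a * b) = x a * x b"
    and trace_nonneg: "0 \<le> a \<Longrightarrow> 0 \<le> x a"
    and trace_zero: "x 0 = 0"
    and trace_diff: "x (a - b) = x a - x b"
    and trace_minus: "x (- a) = - x a"
    and trace_of_nat: "x (of_nat n) = n"
proof -
  have *: "x 1 = 1" "\<And>a b. x (a + b) = x a + x b" "\<And>a b. x (a * b) = x a * x b"
    "\<And>a. 0 \<le> a \<Longrightarrow> 0 \<le> x a"
    using assms unfolding pure_traces_def by auto
  show "x 1 = 1" "x (a + b) = x a + x b" "x (a * b) = x a * x b" "0 \<le> a \<Longrightarrow> 0 \<le> x a"
    using * by auto
  show "x 0 = 0" using *(2)[of 0 0] by simp
  show "x (a - b) = x a - x b" using additive_diff[of x, OF *(2)] .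
  show "x (- a) = - x a" using additive_diff[of x 0 a, OF *(2)] \<open>x 0 = 0\<close> by simp
  show "x (of_nat n) = n" using additive_of_nat[of x n 1, OF *(2)] *(1) by simp
qed

lemma trace_mono: "x \<in> pure_traces \<Longrightarrow> a \<le> b \<Longrightarrow> x a \<le> x b"
  using trace_nonneg[of x "b - a"] trace_diff[of x b a] by simp

lemma total_cone_module_state:
  fixes P :: "'a::partially_ordered_ring set"
  assumes P: "cone_module P" "- 1 \<notin> P" and total: "\<And>a. a \<in> P \<or> - a \<in> P"
  obtains x :: "'a \<Rightarrow> real"
  where "x 1 = 1" "\<And>a b. x (a + b) = x a + x b" "\<And>a. a \<in> P \<Longrightarrow> 0 \<le> x a"
proof -
  note add = cone_module_add[OF P(1)] and mult = cone_module_mult[OF P(1)]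
    and nonneg = cone_module_nonneg[OF P(1)]
  have nmult: "of_nat n * a \<in> P" if "a \<in> P" for n a
    using that by (intro mult cone_of_nat)
  \<comment> \<open>The lower Dedekind cut of \<open>a\<close> for the preorder given by
    \<open>P\<close>. Denominators are cleared because the ring need not contain the
    rationals.\<close>
  define L where "L a = {p / n | (p::int) (n::nat). 0 < n \<and> of_nat n * a - of_int p \<in> P}"
    for a
  define x where "x a = Sup (L a)" for a
  \<comment> \<open>Cross-multiplying a lower and an upper bound cancels \<open>a\<close> and leaves
    an integer in \<open>P\<close>, which cannot be negative.\<close>
  have cut: "real_of_int p / real n \<le> real_of_int q / real m"
    if "0 < n" "0 < m" "of_nat n * a - of_int p \<in> P" "of_int q - of_nat m * a \<in> P"
    for p q :: int and n m :: nat and a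
  proof -
    have "of_nat m * (of_nat n * a - of_int p) + of_nat n * (of_int q - of_nat m * a) \<in> P"
      by (intro add nmult that)
    also have "of_nat m * (of_nat n * a - of_int p) + of_nat n * (of_int q - of_nat m * a)
      = of_int (int n * q - int m * p)" by (simp add: algebra_simps)
    finally have "0 \<le> int n * q - int m * p" using cone_module_of_int P by blast
    then have "real_of_int (int m * p) \<le> real_of_int (int n * q)" by linarith
    then show ?thesis using that(1,2) by (simp add: field_simps)
  qed
  have bdd: "bdd_above (L a)" and ne: "L a \<noteq> {}" for a
  proof -
    obtain N where N: "0 \<le> of_nat N - a" "0 \<le> of_nat N + a" using order_unit_bound by blast
    have "y \<le> real_of_int (int N) / real 1" if "y \<in> L a" for y
      using that cut[of _ 1 a _ "int N"] nonneg[OF N(1)] unfolding L_def by auto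
    then show "bdd_above (L a)" by (rule bdd_aboveI)
    have "real_of_int (- int N) / real 1 \<in> L a"
      unfolding L_def using nonneg[OF N(2)] by (fastforce simp: add.commute)
    then show "L a \<noteq> {}" by blast
  qed
  have lower: "p / n \<le> x a" if "0 < n" "of_nat n * a - of_int p \<in> P"
    for p :: int and n :: nat and a
    unfolding x_def by (rule cSup_upper[OF _ bdd]) (use that in \<open>auto simp: L_def\<close>)
  have upper: "x a \<le> p / n" if "0 < n" "of_int p - of_nat n * a \<in> P"
    for p :: int and n :: nat and a
    unfolding x_def by (rule cSup_least[OF ne]) (use cut[OF _ that(1) _ that(2)] in \<open>auto simp: L_def\<close>)
  \<comment> \<open>Totality turns strict inequalities between \<open>x a\<close> and a fraction
    into membership in \<open>P\<close>.\<close>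
  have above: "of_int p - of_nat n * a \<in> P" if "0 < n" "x a < p / n"
    for p :: int and n :: nat and a
    using total[of "of_int p - of_nat n * a"] lower[of n a p] that by auto
  have below: "of_nat n * a - of_int p \<in> P" if "0 < n" "p / n < x a"
    for p :: int and n :: nat and a
    using total[of "of_int p - of_nat n * a"] upper[of n p a] that by auto
  have "x 1 = 1"
    using lower[of 1 1 1] upper[of 1 1 1] nonneg[of 0] by simp
  moreover have "0 \<le> x a" if "a \<in> P" for a
    using lower[of 1 a 0] that by simp
  moreover have "x (a + b) = x a + x b" for a b
  proof (rule antisym; rule ccontr)
    assume less: "\<not> x (a + b) \<le> x a + x b"
    \<comment> \<open>Half the supposed gap goes to each summand: fractions within \<open>e\<close>
      above \<open>x a\<close> and \<open>x b\<close> add up to an upper bound below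
      \<open>x (a + b)\<close>.\<close>
    define e where "e = (x (a + b) - (x a + x b)) / 2"
    have "0 < e" using less by (simp add: e_def)
    obtain n p where n: "0 < n" "x a < of_int p / real n" "of_int p / real n < x a + e"
      using ex_fraction_between[of "x a" "x a + e"] \<open>0 < e\<close> by auto
    obtain m q where m: "0 < m" "x b < of_int q / real m" "of_int q / real m < x b + e"
      using ex_fraction_between[of "x b" "x b + e"] \<open>0 < e\<close> by auto
    have "of_nat m * (of_int p - of_nat n * a) + of_nat n * (of_int q - of_nat m * b) \<in> P"
      by (intro add nmult above n m)
    then have "of_int (int m * p + int n * q) - of_nat (n * m) * (a + b) \<in> P"
      by (simp add: algebra_simps)
    then have "x (a + b) \<le> of_int (int m * p + int n * q) / real (n * m)"
      using n(1) m(1) by (intro upper) auto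
    also have "\<dots> = of_int p / real n + of_int q / real m"
      using n(1) m(1) by (simp add: field_simps)
    also have "\<dots> < (x a + e) + (x b + e)"
      by (intro add_strict_mono n m)
    also have "\<dots> = x (a + b)" by (simp add: e_def field_simps)
    finally show False by simp
  next
    assume less: "\<not> x a + x b \<le> x (a + b)"
    define e where "e = ((x a + x b) - x (a + b)) / 2"
    have "0 < e" using less by (simp add: e_def)
    obtain n p where n: "0 < n" "x a - e < of_int p / real n" "of_int p / real n < x a"
      using ex_fraction_between[of "x a - e" "x a"] \<open>0 < e\<close> by auto
    obtain m q where m: "0 < m" "x b - e < of_int q / real m" "of_int q / real m < x b"
      using ex_fraction_between[of "x b - e" "x b"] \<open>0 < e\<close> by auto
    have "of_nat m * (of_nat n * a - of_int p) + of_nat n * (of_nat m * b - of_int q) \<in> P"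
      by (intro add nmult below n m)
    then have "of_nat (n * m) * (a + b) - of_int (int m * p + int n * q) \<in> P"
      by (simp add: algebra_simps)
    then have le: "of_int (int m * p + int n * q) / real (n * m) \<le> x (a + b)"
      using n(1) m(1) by (intro lower) auto
    have "x (a + b) = (x a - e) + (x b - e)" by (simp add: e_def field_simps)
    also have "\<dots> < of_int p / real n + of_int q / real m"
      by (intro add_strict_mono n m)
    also have "\<dots> = of_int (int m * p + int n * q) / real (n * m)"
      using n(1) m(1) by (simp add: field_simps)
    finally show False using le by simp
  qed
  ultimately show thesis using that by blast
qed

text \<open>By totality \<open>x\<close> and \<open>f\<close> have compatible signs on every
  \<open>n a - p\<close>, so \<open>x a\<close> and \<open>f a / f 1\<close> admit no fraction
  strictly between them. No normalization of \<open>f\<close> is assumed: the lemma is meant for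
  \<open>a \<mapsto> x (t * a)\<close>, whose value at \<open>1\<close> may vanish.\<close>

lemma total_cone_module_state_unique:
  fixes x f :: "'a::partially_ordered_ring \<Rightarrow> real"
  assumes P: "cone_module P" and total: "\<And>a. a \<in> P \<or> - a \<in> P"
    and x: "x 1 = 1" "\<And>a b. x (a + b) = x a + x b" "\<And>a. a \<in> P \<Longrightarrow> 0 \<le> x a"
    and f: "\<And>a b. f (a + b) = f a + f b" "\<And>a. a \<in> P \<Longrightarrow> 0 \<le> f a"
  shows "f a = x a * f 1"
proof -
  have int: "g (of_nat n * a - of_int p) = n * g a - p * g 1"
    if "\<And>a b. g (a + b) = g a + g b" for g :: "'a \<Rightarrow> real" and n p a
    using additive_diff[of g, OF that] additive_of_nat[of g, OF that]
      additive_of_int[of g, OF that] by simp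
  have f1: "0 \<le> f 1"
    using f(2) cone_module_nonneg[OF P] cone_one by blast
  have cases: "n * x a - p \<ge> 0 \<and> n * f a - p * f 1 \<ge> 0 \<or>
      n * x a - p \<le> 0 \<and> n * f a - p * f 1 \<le> 0" for n :: nat and p :: int
  proof -
    let ?c = "of_nat n * a - of_int p"
    have neg: "g (- ?c) = - g ?c" if "\<And>a b. g (a + b) = g a + g b" for g :: "'a \<Rightarrow> real"
      using additive_diff[of g 0 ?c, OF that] that[of 0 0] by simp
    show ?thesis
      using total[of ?c] x(3)[of ?c] f(2)[of ?c] x(3)[of "- ?c"] f(2)[of "- ?c"]
        int[of x, OF x(2)] int[of f, OF f(1)] neg[of x, OF x(2)] neg[of f, OF f(1)] x(1)
      by auto
  qed
  show ?thesis
  proof (cases "f 1 = 0")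
    case True
    \<comment> \<open>At \<open>a - n\<close> and \<open>a + n\<close> the state \<open>x\<close>
      has opposite strict signs, while \<open>f\<close> takes the value \<open>f a\<close> at both,
      so \<open>f a = 0\<close>.\<close>
    obtain n :: nat where n: "\<bar>x a\<bar> < n" using reals_Archimedean2 by blast
    then show ?thesis
      using cases[of 1 "int n"] cases[of 1 "- int n"] True by auto
  next
    case False
    with f1 have pos: "0 < f 1" by simp
    have eq: "f a = (f a / f 1) * f 1" using False by simp
    have "f a / f 1 = x a"
    proof (rule ccontr)
      assume "f a / f 1 \<noteq> x a"
      then consider "f a / f 1 < x a" | "x a < f a / f 1" by linarith
      then show False
      proof cases
        case 1
        obtain n :: nat and p :: int
          where n: "0 < n" "f a / f 1 < p / n" "p / n < x a"
          using ex_fraction_between[OF 1] by blast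
        then have "n * x a - p > 0" "n * f a - p * f 1 < 0"
          using pos by (auto simp: field_simps)
        then show False using cases[of n p] by linarith
      next
        case 2
        obtain n :: nat and p :: int
          where n: "0 < n" "x a < p / n" "p / n < f a / f 1"
          using ex_fraction_between[OF 2] by blast
        then have "n * x a - p < 0" "n * f a - p * f 1 > 0"
          using pos by (auto simp: field_simps)
        then show False using cases[of n p] by linarith
      qed
    qed
    then show ?thesis using eq by simp
  qed
qed

text \<open>For \<open>t >= 0\<close> the map \<open>a \<mapsto> x (t * a)\<close> is nonnegative on
  \<open>P\<close>, because \<open>P\<close> is a module, so uniqueness makes it \<open>x t\<close>
  times \<open>x\<close>. A general factor \<open>b\<close> is the difference of the positive
  elements \<open>N + b\<close> and \<open>N\<close>.\<close>

lemma total_cone_module_pure_trace: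
  fixes P :: "'a::partially_ordered_ring set"
  assumes P: "cone_module P" "- 1 \<notin> P" and total: "\<And>a. a \<in> P \<or> - a \<in> P"
  obtains x where "x \<in> pure_traces" "\<And>a. a \<in> P \<Longrightarrow> 0 \<le> x a"
proof -
  obtain x :: "'a \<Rightarrow> real"
    where x: "x 1 = 1" "\<And>a b. x (a + b) = x a + x b" "\<And>a. a \<in> P \<Longrightarrow> 0 \<le> x a"
    using total_cone_module_state[OF assms] by blast
  have mult: "x (t * a) = x t * x a" if "0 \<le> t" for t a
  proof -
    have "x (t * a) = x a * x (t * 1)"
      using x cone_module_mult[OF P(1) that]
      by (intro total_cone_module_state_unique[OF P(1) total, of x "\<lambda>a. x (t * a)"])
        (auto simp: algebra_simps)
    then show ?thesis by simp
  qed
  have "x (b * a) = x b * x a" for a b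
  proof -
    obtain N where "0 \<le> of_nat N + b" using order_unit_bound by blast
    then have "x ((of_nat N + b) * a) = (x (of_nat N) + x b) * x a" using mult x(2) by metis
    moreover have "x ((of_nat N + b) * a) = x (of_nat N) * x a + x (b * a)"
      using mult[OF cone_of_nat] x(2) by (simp add: distrib_right)
    ultimately show ?thesis by (simp add: algebra_simps)
  qed
  then have "x \<in> pure_traces"
    using x cone_module_nonneg[OF P(1)] unfolding pure_traces_def by blast
  then show thesis using that x by blast
qed

section \<open>Maximal proper modules and the representation theorem\<close>

lemma ex_maximal_cone_module:
  fixes P :: "'a::partially_ordered_ring set"
  assumes "cone_module P" "- 1 \<notin> P"
  obtains Q where "cone_module Q" "P \<subseteq> Q" "- 1 \<notin> Q"
    "\<And>Q'. cone_module Q' \<Longrightarrow> Q \<subseteq> Q' \<Longrightarrow> - 1 \<notin> Q' \<Longrightarrow> Q' = Q"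
proof -
  let ?A = "{Q. cone_module Q \<and> P \<subseteq> Q \<and> - 1 \<notin> Q}"
  have "\<Union>C \<in> ?A" if "C \<noteq> {}" and C: "subset.chain ?A C" for C
  proof -
    have CA: "C \<subseteq> ?A" using C by (auto simp: subset.chain_def)
    have "cone_module (\<Union>C)"
      unfolding cone_module_def
    proof (intro conjI allI ballI impI)
      fix a :: 'a assume "0 \<le> a"
      then show "a \<in> \<Union>C" using CA \<open>C \<noteq> {}\<close> cone_module_nonneg by fastforce
    next
      fix a b assume "a \<in> \<Union>C" "b \<in> \<Union>C"
      then obtain U V where "U \<in> C" "V \<in> C" "a \<in> U" "b \<in> V" by blast
      then obtain W where "W \<in> C" "a \<in> W" "b \<in> W"
        using subset_chain_def[of ?A C] C by blast
      then show "a + b \<in> \<Union>C" using CA cone_module_add by blast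
    next
      fix t a :: 'a assume "0 \<le> t" "a \<in> \<Union>C"
      then show "t * a \<in> \<Union>C" using CA cone_module_mult by fastforce
    qed
    then show ?thesis using CA \<open>C \<noteq> {}\<close> by blast
  qed
  moreover have "?A \<noteq> {}" using assms by blast
  ultimately obtain Q where Q: "Q \<in> ?A" "\<forall>Q'\<in>?A. Q \<subseteq> Q' \<longrightarrow> Q' = Q"
    using subset_Zorn_nonempty[of ?A] by blast
  show thesis
    by (rule that[of Q]) (use Q in auto)
qed

theorem Kadison_Dubois:
  fixes r :: "'a::partially_ordered_ring"
  assumes "\<And>x. x \<in> pure_traces \<Longrightarrow> 0 < x r"
  obtains N where "0 < N" "1 \<le> of_nat N * r"
proof -
  let ?P = "{m + t * (- r) | m t. m \<in> {a. 0 \<le> a} \<and> 0 \<le> t}"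
  have "cone_module {a::'a. 0 \<le> a}"
    by (auto simp: cone_module_def intro: cone_mult)
  note P = cone_module_extend[OF this, of "- r"]
  have "- 1 \<in> ?P"
  proof (rule ccontr)
    assume "- 1 \<notin> ?P"
    then obtain Q where Q: "cone_module Q" "?P \<subseteq> Q" "- 1 \<notin> Q"
      "\<And>Q'. cone_module Q' \<Longrightarrow> Q \<subseteq> Q' \<Longrightarrow> - 1 \<notin> Q' \<Longrightarrow> Q' = Q"
      using ex_maximal_cone_module[OF P(1)] by blast
    have "a \<in> Q \<or> - a \<in> Q" for a
      using maximal_cone_module_total[OF Q(1,3,4)] .
    then obtain x where x: "x \<in> pure_traces" "\<And>a. a \<in> Q \<Longrightarrow> 0 \<le> x a"
      using total_cone_module_pure_trace[OF Q(1,3)] by blast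
    have "0 \<le> x (- r)" using x(2) Q(2) P(3) by blast
    then show False using assms[OF x(1)] trace_minus[OF x(1)] by simp
  qed
  then obtain a b where a: "0 \<le> a" and b0: "0 \<le> b" and eq: "- 1 = a + b * (- r)" by blast
  have "b * r - 1 = a" using arg_cong[OF eq, of "\<lambda>c. c + b * r"] by (simp add: algebra_simps)
  with a b0 have b: "0 \<le> b" "1 \<le> b * r" using diff_ge_0_iff_ge[of "b * r" 1] by auto
  obtain N where N: "0 < N" "0 \<le> of_nat N - b" using order_unit_bound by blast
  \<comment> \<open>The bound \<open>- K <= r\<close> starts the descent with \<open>p = 1\<close>,
    which trades the ring element \<open>b\<close> for the integer \<open>N\<close>.\<close>
  obtain K where K: "0 \<le> of_nat K + r" using order_unit_bound by blast
  have "0 \<le> of_nat N * (of_nat K + r)" by (intro cone_mult cone_of_nat K)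
  then have "0 \<le> of_nat N * r + of_nat (N * K) * 1" by (simp add: algebra_simps)
  then have "1 \<le> of_nat N * r"
    using descent[OF N(1) b(1) N(2) cone_one b(2)] by blast
  then show thesis using that N by blast
qed

section \<open>Order ideals and multipliers\<close>

lemma multipliers_zero: "0 \<in> multipliers s"
  by (simp add: multipliers_def)

lemma multipliers_add: "a \<in> multipliers s \<Longrightarrow> b \<in> multipliers s \<Longrightarrow> a + b \<in> multipliers s"
  by (simp add: multipliers_def distrib_right)

lemma multipliers_mult: "0 \<le> c \<Longrightarrow> a \<in> multipliers s \<Longrightarrow> c * a \<in> multipliers s"
  by (simp add: multipliers_def mult.assoc cone_mult)

abbreviation (input) mult_ideal :: "'a::partially_ordered_ring \<Rightarrow> 'a set" where
  "mult_ideal s \<equiv> generated_order_ideal {r * s | r. r \<in> multipliers s}"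

text \<open>Since the multipliers of \<open>s\<close> are closed under addition, a single one bounds each element.\<close>

lemma mult_ideal_iff:
  "a \<in> mult_ideal s \<longleftrightarrow> (\<exists>t\<in>multipliers s. - (t * s) \<le> a \<and> a \<le> t * s)"
proof
  assume "a \<in> mult_ideal s"
  then obtain M F where F: "finite F" "F \<subseteq> {r * s | r. r \<in> multipliers s}"
    and a: "- (of_nat M * \<Sum>F) \<le> a" "a \<le> of_nat M * \<Sum>F"
    unfolding generated_order_ideal_def by blast
  have "\<exists>t\<in>multipliers s. \<Sum>F = t * s" using F
  proof (induction F)
    case empty
    then show ?case using multipliers_zero by force
  next
    case (insert b F)
    then obtain t r where "t \<in> multipliers s" "\<Sum>F = t * s" "r \<in> multipliers s" "b = r * s" by auto
    then have "r + t \<in> multipliers s" "\<Sum>(insert b F) = (r + t) * s"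
      using insert.hyps by (auto simp: multipliers_add algebra_simps)
    then show ?case by blast
  qed
  then obtain t where t: "t \<in> multipliers s" "\<Sum>F = t * s" by blast
  then show "\<exists>t\<in>multipliers s. - (t * s) \<le> a \<and> a \<le> t * s"
    using a multipliers_mult[OF cone_of_nat t(1), of M]
    by (intro bexI[of _ "of_nat M * t"]) (auto simp: mult.assoc)
next
  assume "\<exists>t\<in>multipliers s. - (t * s) \<le> a \<and> a \<le> t * s"
  then obtain t where "t \<in> multipliers s" "- (t * s) \<le> a" "a \<le> t * s" by blast
  then show "a \<in> mult_ideal s"
    unfolding generated_order_ideal_def
    by (intro CollectI exI[of _ 1] exI[of _ "{t * s}"]) auto
qed

lemma mult_ideal_multiplier: "r \<in> multipliers s \<Longrightarrow> r * s \<in> mult_ideal s"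
  unfolding mult_ideal_iff using order_trans[of "- (r * s)" 0 "r * s"]
  by (intro bexI[of _ r]) (simp_all add: multipliers_def)

lemma is_ideal_mult_ideal:
  fixes s :: "'a::partially_ordered_ring"
  shows "is_ideal (mult_ideal s)"
  unfolding is_ideal_def
proof (intro conjI allI ballI)
  show "0 \<in> mult_ideal s"
    using mult_ideal_multiplier[OF multipliers_zero, of s] by simp
next
  fix a b assume "a \<in> mult_ideal s" "b \<in> mult_ideal s"
  then obtain t u where t: "t \<in> multipliers s" "- (t * s) \<le> a" "a \<le> t * s"
    and u: "u \<in> multipliers s" "- (u * s) \<le> b" "b \<le> u * s"
    unfolding mult_ideal_iff by blast
  show "a + b \<in> mult_ideal s"
    unfolding mult_ideal_iff using t(1) u(1) add_mono[OF t(2) u(2)] add_mono[OF t(3) u(3)]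
    by (intro bexI[of _ "t + u"]) (simp_all add: multipliers_add distrib_right)
next
  fix r a :: 'a assume "a \<in> mult_ideal s"
  then obtain t where t: "t \<in> multipliers s" "- (t * s) \<le> a" "a \<le> t * s"
    unfolding mult_ideal_iff by blast
  obtain N where N: "0 \<le> of_nat N - r" "0 \<le> of_nat N + r" using order_unit_bound[of r] by blast
  have ta: "0 \<le> t * s - a" "0 \<le> t * s + a"
    using t(3) add_left_mono[OF t(2), of "t * s"] by auto
  \<comment> \<open>The factor \<open>r\<close> has no sign, but the mixed terms cancel: the two
    sums equal \<open>2 (N t s - r a)\<close> and \<open>2 (N t s + r a)\<close>.\<close>
  have "0 \<le> (of_nat N + r) * (t * s - a) + (of_nat N - r) * (t * s + a)"
    "0 \<le> (of_nat N - r) * (t * s - a) + (of_nat N + r) * (t * s + a)"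
    by (intro add_nonneg_nonneg cone_mult N ta)+
  then have "0 \<le> of_nat 2 * (of_nat N * t * s - r * a)" "0 \<le> of_nat 2 * (of_nat N * t * s + r * a)"
    by (simp_all add: algebra_simps)
  then have ra: "0 \<le> of_nat N * t * s - r * a" "0 \<le> of_nat N * t * s + r * a"
    using unperforated[OF pos2] by blast+
  have "- (of_nat N * t * s) \<le> r * a"
    using add_left_mono[OF ra(2), of "- (of_nat N * t * s)"] by simp
  with ra(1) show "r * a \<in> mult_ideal s"
    unfolding mult_ideal_iff using multipliers_mult[OF cone_of_nat t(1), of N]
    by (intro bexI[of _ "of_nat N * t"]) simp_all
qed

text \<open>Domination is tested on pure traces instead of in the ring, since positivity of
  multipliers is at first known only there.\<close>

definition trace_dominated :: "'a::partially_ordered_ring \<Rightarrow> 'a set" where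
  "trace_dominated s = {a. \<exists>t\<in>multipliers s. \<forall>x\<in>pure_traces. \<bar>x a\<bar> \<le> x t}"

lemma is_ideal_trace_dominated:
  fixes s :: "'a::partially_ordered_ring"
  shows "is_ideal (trace_dominated s)"
  unfolding is_ideal_def trace_dominated_def
proof (intro conjI allI ballI CollectI)
  show "\<exists>t\<in>multipliers s. \<forall>x\<in>pure_traces. \<bar>x 0\<bar> \<le> x t"
    by (rule bexI[of _ 0]) (auto simp: multipliers_zero trace_zero)
next
  fix a b
  assume "a \<in> {a. \<exists>t\<in>multipliers s. \<forall>x\<in>pure_traces. \<bar>x a\<bar> \<le> x t}"
    "b \<in> {a. \<exists>t\<in>multipliers s. \<forall>x\<in>pure_traces. \<bar>x a\<bar> \<le> x t}"
  then obtain t u where t: "t \<in> multipliers s" "\<And>x. x \<in> pure_traces \<Longrightarrow> \<bar>x a\<bar> \<le> x t"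
    and u: "u \<in> multipliers s" "\<And>x. x \<in> pure_traces \<Longrightarrow> \<bar>x b\<bar> \<le> x u"
    by blast
  have "\<bar>x (a + b)\<bar> \<le> x (t + u)" if "x \<in> pure_traces" for x
    using t(2)[OF that] u(2)[OF that] by (simp add: trace_add[OF that])
  then show "\<exists>t\<in>multipliers s. \<forall>x\<in>pure_traces. \<bar>x (a + b)\<bar> \<le> x t"
    using multipliers_add t(1) u(1) by blast
next
  fix r a :: 'a
  assume "a \<in> {a. \<exists>t\<in>multipliers s. \<forall>x\<in>pure_traces. \<bar>x a\<bar> \<le> x t}"
  then obtain t where t: "t \<in> multipliers s" "\<And>x. x \<in> pure_traces \<Longrightarrow> \<bar>x a\<bar> \<le> x t"
    by blast
  obtain N where N: "0 \<le> of_nat N - r" "0 \<le> of_nat N + r" using order_unit_bound[of r] by blast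
  have "\<bar>x (r * a)\<bar> \<le> x (of_nat N * t)" if x: "x \<in> pure_traces" for x
  proof -
    have "\<bar>x r\<bar> \<le> N"
      using trace_nonneg[OF x N(1)] trace_nonneg[OF x N(2)]
      by (simp add: trace_add[OF x] trace_diff[OF x] trace_of_nat[OF x])
    then have "\<bar>x r\<bar> * \<bar>x a\<bar> \<le> N * x t"
      using t(2)[OF x] by (intro mult_mono) auto
    then show ?thesis by (simp add: trace_mult[OF x] trace_of_nat[OF x] abs_mult)
  qed
  then show "\<exists>t\<in>multipliers s. \<forall>x\<in>pure_traces. \<bar>x (r * a)\<bar> \<le> x t"
    using multipliers_mult[OF cone_of_nat t(1)] by blast
qed

text \<open>The assumption \<open>gen\<close> states hypothesis (b) as an induction principle over
  ideals, in a form that serves \<open>s\<close> and \<open>- s\<close> alike.\<close>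

lemma nonneg_if_multipliers_nonneg:
  fixes s :: "'a::partially_ordered_ring"
  assumes gen: "\<And>I. is_ideal I \<Longrightarrow> mult_ideal s \<subseteq> I \<Longrightarrow> multipliers s \<subseteq> I \<Longrightarrow> 1 \<in> I"
    and pos: "\<And>x r. x \<in> pure_traces \<Longrightarrow> r \<in> multipliers s \<Longrightarrow> 0 \<le> x r"
  shows "0 \<le> s"
proof -
  note J = is_ideal_mult_ideal[of s, unfolded is_ideal_def]
  have "1 \<in> {a. a * s \<in> mult_ideal s}"
  proof (rule gen)
    show "is_ideal {a. a * s \<in> mult_ideal s}"
      using J by (simp add: is_ideal_def distrib_right mult.assoc)
    show "mult_ideal s \<subseteq> {a. a * s \<in> mult_ideal s}"
      using J by (auto simp: mult.commute[of _ s] simp del: mem_Collect_eq intro!: CollectI)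
    show "multipliers s \<subseteq> {a. a * s \<in> mult_ideal s}"
      using mult_ideal_multiplier by blast
  qed
  then obtain t where t: "t \<in> multipliers s" "- (t * s) \<le> s"
    by (auto simp: mult_ideal_iff)
  have "1 \<in> trace_dominated s"
  proof (rule gen[OF is_ideal_trace_dominated])
    show "multipliers s \<subseteq> trace_dominated s"
      unfolding trace_dominated_def using pos by force
    then have rs: "r * s \<in> trace_dominated s"
      if "r \<in> multipliers s" for r
      using that is_ideal_trace_dominated[of s, unfolded is_ideal_def]
      by (metis mult.commute subsetD)
    then show "mult_ideal s \<subseteq> trace_dominated s"
    proof (intro subsetI)
      fix a assume "a \<in> mult_ideal s"
      then obtain r where r: "r \<in> multipliers s" "- (r * s) \<le> a" "a \<le> r * s"
        unfolding mult_ideal_iff by blast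
      have "\<bar>x a\<bar> \<le> \<bar>x (r * s)\<bar>" if "x \<in> pure_traces" for x
        using trace_mono[OF that r(2)] trace_mono[OF that r(3)] trace_minus[OF that] by simp
      then show "a \<in> trace_dominated s"
        using rs[OF r(1)] unfolding trace_dominated_def by (blast intro: order_trans)
    qed
  qed
  then obtain t' where t': "t' \<in> multipliers s" "\<And>x. x \<in> pure_traces \<Longrightarrow> 1 \<le> x t'"
    unfolding trace_dominated_def using trace_one by force
  \<comment> \<open>Here \<open>t\<close> supplies the lower bound on \<open>s\<close> and
    \<open>t'\<close> strict positivity on the traces. Both survive in the sum, since
    \<open>t\<close> is nonnegative on traces and \<open>t' * s >= 0\<close>.\<close>
  let ?u = "t + t'"
  have "0 < x ?u" if "x \<in> pure_traces" for x
    using pos[OF that t(1)] t'(2)[OF that] by (simp add: trace_add[OF that])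
  then obtain n where n: "0 < n" "1 \<le> of_nat n * ?u" using Kadison_Dubois by blast
  then have u: "0 \<le> ?u" using unperforated order_trans[OF cone_one] by blast
  have us: "0 \<le> ?u * s" using multipliers_add[OF t(1) t'(1)] by (simp add: multipliers_def)
  obtain N where N: "0 < N" "0 \<le> of_nat N - ?u" using order_unit_bound[of ?u] by blast
  have "0 \<le> s + t * s" using add_right_mono[OF t(2), of "t * s"] by simp
  then have "0 \<le> (s + t * s) + t' * s"
    by (rule add_nonneg_nonneg) (use t'(1) in \<open>simp add: multipliers_def\<close>)
  then have "0 \<le> of_nat N * (s + ?u * s)"
    by (intro cone_mult cone_of_nat) (simp add: algebra_simps)
  then have "0 \<le> of_nat N * s + of_nat N * (?u * s)" by (simp add: distrib_left)
  \<comment> \<open>The descent runs with \<open>b = u\<close>, \<open>r = s\<close>,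
    \<open>p = u s\<close> and \<open>K = N\<close>; its condition \<open>p <= b r\<close> is an
    equality.\<close>
  then have "?u * s \<le> of_nat N * s" by (intro descent[OF N(1) u N(2) us order_refl])
  then show ?thesis using us N(1) unperforated order_trans by blast
qed

section \<open>Signs on the pure trace space\<close>

lemma
  shows open_trace_pos: "open {x :: 'a \<Rightarrow> real. 0 < x r}"
    and open_trace_neg: "open {x :: 'a \<Rightarrow> real. x r < 0}"
  by (rule open_Collect_less[OF continuous_on_const continuous_on_product_coordinates]
      open_Collect_less[OF continuous_on_product_coordinates continuous_on_const])+

text \<open>Otherwise \<open>X \<inter> W\<close> would be a nonempty relatively open subset of the
  closure of \<open>Z\<close>.\<close>

lemma nowhere_dense_inD:
  assumes "nowhere_dense_in (top_of_set X) Z" "open W" "x \<in> W" "x \<in> X" "Z \<subseteq> X"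
  obtains y where "y \<in> W" "y \<in> X" "y \<notin> Z"
proof -
  have "\<not> X \<inter> W \<subseteq> Z"
  proof
    assume "X \<inter> W \<subseteq> Z"
    also have "Z \<subseteq> top_of_set X closure_of Z"
      using \<open>Z \<subseteq> X\<close> by (intro closure_of_subset) auto
    finally have "X \<inter> W \<subseteq> top_of_set X interior_of (top_of_set X closure_of Z)"
      using openin_open_Int[OF \<open>open W\<close>] by (intro interior_of_maximal)
    then show False using assms unfolding nowhere_dense_in_def by blast
  qed
  then show thesis using that by blast
qed

theorem proposition7:
  fixes s :: "'a::partially_ordered_ring"
  assumes "connected (pure_traces :: ('a \<Rightarrow> real) set)"
    and "nowhere_dense_in (top_of_set pure_traces) {x \<in> pure_traces. x s = 0}"
    and "is_ideal hull
      (generated_order_ideal {r * s | r. r \<in> multipliers s} \<union> multipliers s) = UNIV"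
  shows "0 \<le> s \<or> 0 \<le> - s"
proof -
  let ?X = "pure_traces :: ('a \<Rightarrow> real) set"
  have gen: "1 \<in> I" if "is_ideal I" "mult_ideal s \<subseteq> I" "multipliers s \<subseteq> I" for I
    using hull_minimal[of "mult_ideal s \<union> multipliers s" I is_ideal] that assms(3) by auto
  have dense: "\<exists>y\<in>W \<inter> ?X. y s \<noteq> 0" if "open W" "x \<in> W" "x \<in> ?X" for W x
    using nowhere_dense_inD[OF assms(2) that] by blast
  have rs: "0 \<le> x r * x s" if "x \<in> ?X" "r \<in> multipliers s" for x r
    using that trace_nonneg[OF that(1), of "r * s"] trace_mult[OF that(1)]
    by (simp add: multipliers_def)
  \<comment> \<open>If \<open>x\<close> killed all multipliers, its kernel would also contain the
    order ideal, whose elements are squeezed between \<open>- (r * s)\<close> and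
    \<open>r * s\<close>; then \<open>x 1 = 0\<close>.\<close>
  have nonzero: "\<exists>r\<in>multipliers s. x r \<noteq> 0" if x: "x \<in> ?X" for x
  proof (rule ccontr)
    assume *: "\<not> ?thesis"
    have "1 \<in> {a. x a = 0}"
    proof (rule gen)
      show "is_ideal {a. x a = 0}"
        by (simp add: is_ideal_def trace_zero[OF x] trace_add[OF x] trace_mult[OF x])
      show "multipliers s \<subseteq> {a. x a = 0}" using * by blast
      show "mult_ideal s \<subseteq> {a. x a = 0}"
      proof
        fix a assume "a \<in> mult_ideal s"
        then obtain r where "r \<in> multipliers s" "- (r * s) \<le> a" "a \<le> r * s"
          unfolding mult_ideal_iff by blast
        moreover from this(1) * have "x (r * s) = 0" using trace_mult[OF x] by simp
        ultimately show "a \<in> {a. x a = 0}"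
          using trace_mono[OF x, of a] trace_mono[OF x, of _ a] trace_minus[OF x, of "r * s"]
          by force
      qed
    qed
    then show False using trace_one[OF x] by simp
  qed
  \<comment> \<open>The inequalities are weak so that traces vanishing at \<open>s\<close> are
    covered too. On \<open>U \<inter> V \<inter> ?X\<close> the value at \<open>s\<close> is
    \<open>0\<close>, which density of the nonzero values rules out.\<close>
  define U where "U = \<Union>{W. open W \<and> (\<forall>y\<in>W \<inter> ?X. 0 \<le> y s)}"
  define V where "V = \<Union>{W. open W \<and> (\<forall>y\<in>W \<inter> ?X. y s \<le> 0)}"
  have "open U" "open V" unfolding U_def V_def by auto
  moreover have "U \<inter> V \<inter> ?X = {}"
  proof (rule ccontr)
    assume "U \<inter> V \<inter> ?X \<noteq> {}"
    then obtain x where "x \<in> U \<inter> V" "x \<in> ?X" by blast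
    then obtain y where "y \<in> U \<inter> V" "y \<in> ?X" "y s \<noteq> 0"
      using dense[of "U \<inter> V" x] \<open>open U\<close> \<open>open V\<close> by blast
    then show False unfolding U_def V_def by (auto dest!: bspec)
  qed
  moreover have "?X \<subseteq> U \<union> V"
  proof
    fix x assume x: "x \<in> ?X"
    obtain r where r: "r \<in> multipliers s" "x r \<noteq> 0" using nonzero[OF x] by blast
    show "x \<in> U \<union> V"
    proof (cases "0 < x r")
      case True
      have "0 \<le> y s" if "y \<in> {x. 0 < x r} \<inter> ?X" for y
        using rs[of y r] r that by (auto simp: zero_le_mult_iff)
      then show ?thesis using open_trace_pos[of r] True unfolding U_def by blast
    next
      case False
      have "y s \<le> 0" if "y \<in> {x. x r < 0} \<inter> ?X" for y
        using rs[of y r] r that by (auto simp: zero_le_mult_iff)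
      moreover have "x r < 0" using False r by simp
      ultimately show ?thesis using open_trace_neg[of r] unfolding V_def by blast
    qed
  qed
  ultimately have "U \<inter> ?X = {} \<or> V \<inter> ?X = {}"
    using connectedD[OF assms(1)] by blast
  then have "?X \<subseteq> U \<or> ?X \<subseteq> V" using \<open>?X \<subseteq> U \<union> V\<close> by blast
  then consider "\<And>x. x \<in> ?X \<Longrightarrow> 0 \<le> x s" | "\<And>x. x \<in> ?X \<Longrightarrow> x s \<le> 0"
    unfolding U_def V_def by blast
  then show ?thesis
  proof cases
    case 1
    \<comment> \<open>A multiplier negative at \<open>x\<close> stays negative nearby, and density
      gives a nearby \<open>y\<close> with \<open>y s > 0\<close>, contradicting
      \<open>y r * y s >= 0\<close>.\<close>
    have "0 \<le> x r" if x: "x \<in> ?X" and r: "r \<in> multipliers s" for x r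
    proof (rule ccontr)
      assume "\<not> 0 \<le> x r"
      then obtain y where "y r < 0" "y \<in> ?X" "y s \<noteq> 0"
        using dense[OF open_trace_neg[of r], of x] x by auto
      then show False using rs[of y r] 1[of y] r by (auto simp: zero_le_mult_iff)
    qed
    then show ?thesis using nonneg_if_multipliers_nonneg[OF gen] by blast
  next
    case 2
    have pos: "0 \<le> x (- r)" if x: "x \<in> ?X" and r: "r \<in> multipliers s" for x r
    proof (rule ccontr)
      assume "\<not> 0 \<le> x (- r)"
      then obtain y where "0 < y r" "y \<in> ?X" "y s \<noteq> 0"
        using dense[OF open_trace_pos[of r], of x] x trace_minus[OF x] by auto
      then show False using rs[of y r] 2[of y] r by (auto simp: zero_le_mult_iff)
    qed
    \<comment> \<open>Passing from \<open>s\<close> to \<open>- s\<close> negates the multipliers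
      and preserves the set of products, so hypothesis (b) carries over.\<close>
    have mult: "r \<in> multipliers (- s) \<longleftrightarrow> - r \<in> multipliers s" for r
      by (simp add: multipliers_def)
    have "{r * - s | r. r \<in> multipliers (- s)} = {r * s | r. r \<in> multipliers s}"
      by (auto simp: mult) (metis minus_mult_minus minus_minus mult mult_minus_left mult_minus_right)+
    then have J: "mult_ideal (- s) = mult_ideal s" by simp
    have "0 \<le> - s"
    proof (rule nonneg_if_multipliers_nonneg)
      show "1 \<in> I" if I: "is_ideal I" "mult_ideal (- s) \<subseteq> I" "multipliers (- s) \<subseteq> I" for I
      proof (rule gen[OF I(1)])
        show "multipliers s \<subseteq> I"
        proof
          fix r assume "r \<in> multipliers s"
          then have "- r \<in> I" using I(3) mult[of "- r"] by auto
          then have "- 1 * - r \<in> I" using I(1) unfolding is_ideal_def by blast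
          then show "r \<in> I" by simp
        qed
      qed (use I(2) J in simp)
      show "0 \<le> x r" if "x \<in> ?X" "r \<in> multipliers (- s)" for x r
        using pos[of x "- r"] that mult by simp
    qed
    then show ?thesis ..
  qed
qed

end
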